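(* Let $0<\alpha\le 1$. For every $f\in\mathcal{S}_{ex}^{\ast}$ (the class with parameter $\alpha$), the inverse logarithmic coefficients $\Gamma_1,\Gamma_2$ of $f$ satisfy \[ -\frac{\alpha}{2}\sqrt{\frac{2}{3\alpha+2}}\;\le\; |\Gamma_2|-|\Gamma_1|\;\le\;\frac{\alpha}{4}. \] Both inequalities are sharp for all $\alpha\in(0,1]$: for each such $\alpha$ there is a function in $\mathcal{S}_{ex}^{\ast}$ attaining equality in the left inequality and a function in $\mathcal{S}_{ex}^{\ast}$ attaining equality in the right inequality.
   Context: Let $\mathbb{D}=\{z\in\mathbb{C}:|z|<1\}$. Let $\mathcal{A}$ be the class of analytic functions $f$ in $\mathbb{D}$ of the form $f(z)=z+\sum_{n=2}^{\infty}a_nz^n$. For analytic $F,G$ in $\mathbb{D}$, $F\prec G$ ($F$ is subordinate to $G$) means that there is an analytic $\omega:\mathbb{D}\to\mathbb{D}$ with $\omega(0)=0$ and $F(z)=G(\omega(z))$ for $z\in\mathbb{D}$. For $0<\alpha\le1$, $\mathcal{S}_{ex}^{\ast}$ is the class of all $f\in\mathcal{A}$ such that $\frac{zf'(z)}{f(z)}\prec e^{\alpha z}$ in $\mathbb{D}$ (the quotient being given the value $1$ at $z=0$); such $f$ are univalent. The inverse logarithmic coefficients $\Gamma_n$ of $f$ are defined by the expansion, near $w=0$, $\log\frac{f^{-1}(w)}{w}=2\sum_{n=1}^{\infty}\Gamma_nw^n$, where $f^{-1}$ is the local inverse of $f$ at $0$ and the logarithm vanishes at $w=0$. Equivalently,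 $\Gamma_1=-\frac12a_2$ and $\Gamma_2=-\frac12a_3+\frac34a_2^2$. *)

theory Defs
  imports "HOL-Complex_Analysis.Complex_Analysis"
begin

abbreviation unit_disc :: "complex set" ("\<D>") where
  "\<D> \<equiv> ball 0 1"

definition class_A :: "(complex \<Rightarrow> complex) set" where
  "class_A = {f. f holomorphic_on \<D> \<and>
     (\<exists>a :: nat \<Rightarrow> complex. a 0 = 0 \<and> a 1 = 1 \<and> (\<forall>z\<in>\<D>. (\<lambda>n. a n * z ^ n) sums f z))}"

definition subordinate :: "(complex \<Rightarrow> complex) \<Rightarrow> (complex \<Rightarrow> complex) \<Rightarrow> bool"
    (infix "\<prec>\<^sub>D" 50) where
  "F \<prec>\<^sub>D G \<longleftrightarrow> F holomorphic_on \<D> \<and> G holomorphic_on \<D> \<and>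
     (\<exists>\<omega>. \<omega> holomorphic_on \<D> \<and> \<omega> ` \<D> \<subseteq> \<D> \<and> \<omega> 0 = 0 \<and> (\<forall>z\<in>\<D>. F z = G (\<omega> z)))"

(* No separate condition f z \<noteq> 0 for z \<noteq> 0 is needed in class_S_ex: at a zero of f the quotient
   below would be 0 (division by zero), which is not a value of exp. *)
definition starlike_quotient :: "(complex \<Rightarrow> complex) \<Rightarrow> complex \<Rightarrow> complex" where
  "starlike_quotient f z = (if z = 0 then 1 else z * deriv f z / f z)"

definition class_S_ex :: "real \<Rightarrow> (complex \<Rightarrow> complex) set" where
  "class_S_ex \<alpha> = {f \<in> class_A. starlike_quotient f \<prec>\<^sub>D (\<lambda>z. exp (complex_of_real \<alpha> * z))}"

definition local_inverse_at_0 :: "(complex \<Rightarrow> complex) \<Rightarrow> (complex \<Rightarrow> complex) \<Rightarrow> bool" where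
  "local_inverse_at_0 f g \<longleftrightarrow> g analytic_on {0} \<and> g 0 = 0 \<and>
     (\<forall>\<^sub>F w in nhds 0. f (g w) = w) \<and> (\<forall>\<^sub>F z in nhds 0. g (f z) = z)"

(* For f in class_A one has g w / w \<longlongrightarrow> 1 as w \<longlongrightarrow> 0, so near 0 the principal logarithm Ln gives the
   branch of log (g w / w) that vanishes at w = 0.  The value \<Gamma> 0 does not enter. *)
definition inverse_log_expansion :: "(complex \<Rightarrow> complex) \<Rightarrow> (nat \<Rightarrow> complex) \<Rightarrow> bool" where
  "inverse_log_expansion f \<Gamma> \<longleftrightarrow> (\<exists>g. local_inverse_at_0 f g \<and>
     (\<forall>\<^sub>F w in at 0. (\<lambda>n. 2 * (\<Gamma> (Suc n) * w ^ Suc n)) sums Ln (g w / w)))"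

(* Meaningful for n \<ge> 1 only; \<Gamma> n is then uniquely determined by the expansion. *)
definition inverse_log_coeff :: "(complex \<Rightarrow> complex) \<Rightarrow> nat \<Rightarrow> complex" where
  "inverse_log_coeff f n = (THE c. \<exists>\<Gamma>. inverse_log_expansion f \<Gamma> \<and> \<Gamma> n = c)"

end

theory Submission imports Defs begin

text \<open>
  Membership in the class means \<open>z f'(z) / f(z) = exp (\<alpha> \<omega>(z))\<close> for a holomorphic self-map
  \<open>\<omega>(z) = c z + d z\<^sup>2 + \<dots>\<close> of the disc fixing \<open>0\<close>.  Comparing power series
  in \<open>z f' = f exp (\<alpha> \<omega>)\<close> gives \<open>a\<^sub>2 = \<alpha> c\<close> and \<open>a\<^sub>3 = \<alpha> d / 2 + 3 \<alpha>\<^sup>2 c\<^sup>2 / 4\<close>;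
  comparing them in \<open>f (w exp (L(w))) = w\<close>, where \<open>L\<close> is the logarithm of \<open>f\<^sup>-\<^sup>1(w) / w\<close>,
  expresses the inverse logarithmic coefficients through \<open>a\<^sub>2\<close> and \<open>a\<^sub>3\<close>.  Together
  (\<open>inverse_log_coeff_schwarz\<close>)
  \<open>\<Gamma>\<^sub>1 = - \<alpha> c / 2\<close> and \<open>\<Gamma>\<^sub>2 = 3 \<alpha>\<^sup>2 c\<^sup>2 / 8 - \<alpha> d / 4\<close>.

  The only constraint on the two coefficients of \<open>\<omega>\<close> is the Schwarz--Pick inequality
  \<open>\<bar>d\<bar> \<le> 1 - \<bar>c\<bar>\<^sup>2\<close> (\<open>schwarz_pick_second_coeff\<close>).  Writing \<open>x = \<bar>c\<bar>\<close>, the triangle inequality turns both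
  bounds into statements about a quadratic polynomial in \<open>x\<close> (\<open>coeff_difference_bounds\<close>).
  For the lower bound the decisive point is \<open>b = sqrt (2 / (3 \<alpha> + 2))\<close>, where
  \<open>3 \<alpha>\<^sup>2 b\<^sup>2 / 8 = \<alpha> (1 - b\<^sup>2) / 4\<close>: up to \<open>x = b\<close> the number \<open>\<Gamma>\<^sub>2\<close> may vanish and \<open>-\<bar>\<Gamma>\<^sub>1\<bar>\<close> alone decides,
  while beyond \<open>b\<close> the forced growth of \<open>\<bar>\<Gamma>\<^sub>2\<bar>\<close> outweighs that of \<open>\<bar>\<Gamma>\<^sub>1\<bar>\<close>.

  Every \<open>\<omega>\<close> as above comes from some member of the class, obtained by integrating
  \<open>(exp (\<alpha> \<omega>(z)) - 1) / z\<close> (\<open>ex_class_S_ex\<close>).  The Blaschke products \<open>z (z + b) / (1 + b z)\<close> have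
  \<open>c = b\<close> and \<open>d = 1 - b\<^sup>2\<close>; the value of \<open>b\<close> above makes \<open>\<Gamma>\<^sub>2 = 0\<close> and gives equality on
  the left, and \<open>b = 0\<close>, that is \<open>\<omega>(z) = z\<^sup>2\<close>, gives equality on the right.
\<close>

unbundle no vec_syntax
unbundle fps_syntax

section \<open>Low-order coefficients of power series\<close>

lemma fps_compose_nth_1_2_3:
  fixes A B :: "'a::comm_ring_1 fps"
  assumes "B $ 0 = 0"
  shows "(A oo B) $ 1 = A $ 1 * B $ 1"
    and "(A oo B) $ 2 = A $ 1 * B $ 2 + A $ 2 * (B $ 1)^2"
    and "(A oo B) $ 3 = A $ 1 * B $ 3 + 2 * A $ 2 * B $ 1 * B $ 2 + A $ 3 * (B $ 1)^3"
  using assms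
  by (simp_all add: fps_compose_nth fps_mult_nth eval_nat_numeral algebra_simps)

lemma fps_exp_compose_nth_1_2:
  fixes W :: "complex fps"
  assumes "W $ 0 = 0"
  shows "(fps_exp c oo W) $ 1 = c * W $ 1"
    and "(fps_exp c oo W) $ 2 = c * W $ 2 + c^2 / 2 * (W $ 1)^2"
  using fps_compose_nth_1_2_3[OF assms, of "fps_exp c"] by (simp_all add: fact_numeral)

lemma fps_expansion_unique_eventually:
  fixes F G :: "complex fps"
  assumes "f has_fps_expansion F" "g has_fps_expansion G" "\<forall>\<^sub>F z in nhds 0. f z = g z"
  shows "F = G"
  using assms has_fps_expansion_cong[OF assms(3) refl] fps_expansion_unique_complex by blast

section \<open>The Schwarz--Pick inequality for the second coefficient\<close>

text \<open>
  The quotient \<open>h(z) = \<omega>(z) / z\<close> maps the disc into itself unless \<open>\<omega>\<close> is a rotation, in which case the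
  second coefficient is \<open>0\<close>.  Otherwise the disc automorphism sending \<open>h(0)\<close> to \<open>0\<close> makes the Schwarz
  lemma applicable to \<open>h\<close>, and its derivative at \<open>h(0)\<close> is \<open>1 / (1 - \<bar>h(0)\<bar>\<^sup>2)\<close>.
\<close>
lemma schwarz_pick_second_coeff:
  assumes hol: "\<omega> holomorphic_on \<D>" and maps: "\<omega> ` \<D> \<subseteq> \<D>" and zero: "\<omega> 0 = 0"
    and W: "\<omega> has_fps_expansion W"
  shows "cmod (W $ 2) \<le> 1 - (cmod (W $ 1))\<^sup>2"
proof -
  obtain h where h: "h holomorphic_on \<D>" "\<And>z. cmod z < 1 \<Longrightarrow> \<omega> z = z * h z" "deriv \<omega> 0 = h 0"
    using Schwarz3[OF hol zero] by metis
  have H: "h has_fps_expansion fps_expansion h 0" (is "_ has_fps_expansion ?H")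
    using h(1) by (intro has_fps_expansion_fps_expansion[of \<D>]) auto
  have near: "\<forall>\<^sub>F z in nhds 0. z \<in> \<D>"
    by (intro eventually_nhds_in_open) auto
  have "(\<lambda>z. z * h z) has_fps_expansion fps_X * ?H"
    by (intro fps_expansion_intros H)
  moreover have "\<forall>\<^sub>F z in nhds 0. \<omega> z = z * h z"
    using near by eventually_elim (simp add: h(2))
  ultimately have "W = fps_X * ?H"
    using W fps_expansion_unique_eventually by blast
  then have W1: "W $ 1 = h 0" and W2: "W $ 2 = deriv h 0"
    by (simp_all add: fps_expansion_def eval_nat_numeral)
  have lt: "cmod (\<omega> z) < 1" if "cmod z < 1" for z
    using maps that by (auto simp: image_subset_iff)
  note SL = Schwarz_Lemma[OF hol zero lt]
  show ?thesis
  proof (cases "(\<exists>z. cmod z < 1 \<and> z \<noteq> 0 \<and> cmod (\<omega> z) = cmod z) \<or> cmod (deriv \<omega> 0) = 1")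
    case True
    then obtain \<beta> where b: "\<forall>z. cmod z < 1 \<longrightarrow> \<omega> z = \<beta> * z" "cmod \<beta> = 1"
      using SL(3)[of 0] by auto
    have "\<forall>\<^sub>F z in nhds 0. \<omega> z = \<beta> * z"
      using near by eventually_elim (simp add: b(1))
    moreover have "(\<lambda>z. \<beta> * z) has_fps_expansion fps_const \<beta> * fps_X"
      by (intro fps_expansion_intros)
    ultimately have "W = fps_const \<beta> * fps_X"
      using W fps_expansion_unique_eventually by blast
    then show ?thesis using b(2) by simp
  next
    case False
    have hlt: "cmod (h z) < 1" if "cmod z < 1" for z
    proof (cases "z = 0")
      case True
      then show ?thesis using False h(3) SL(2)[of 0] by (simp add: less_le)
    next
      case nz: False
      then have "cmod (\<omega> z) < cmod z"
        using False SL(1)[OF _ that] that nz by (metis less_le)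
      then show ?thesis using nz that by (simp add: h(2) norm_mult)
    qed
    define a where "a = h 0"
    have a: "cmod a < 1" using hlt[of 0] by (simp add: a_def)
    define \<phi> where "\<phi> = Moebius_function 0 a \<circ> h"
    have \<phi>hol: "\<phi> holomorphic_on \<D>"
      unfolding \<phi>_def
      by (rule holomorphic_on_compose_gen[OF h(1) Moebius_function_holomorphic[OF a]])
         (auto simp: hlt)
    have \<phi>0: "\<phi> 0 = 0" by (simp add: \<phi>_def a_def Moebius_function_eq_zero)
    have \<phi>lt: "cmod (\<phi> z) < 1" if "cmod z < 1" for z
      using Moebius_function_norm_lt_1[OF a hlt[OF that]] by (simp add: \<phi>_def)
    have d1: "cmod (deriv \<phi> 0) \<le> 1"
      using Schwarz_Lemma(2)[OF \<phi>hol \<phi>0 \<phi>lt, of 0] by simp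
    have nz: "1 - cnj a * h z \<noteq> 0" if "cmod z < 1" for z
    proof
      assume "1 - cnj a * h z = 0"
      then have "cmod (cnj a * h z) = 1" by simp
      moreover have "cmod a * cmod (h z) < 1"
        using a hlt[OF that] mult_strict_mono'[of "cmod a" 1 "cmod (h z)" 1] by simp
      ultimately show False by (simp add: norm_mult)
    qed
    \<comment> \<open>Clearing the denominator lets the product rule at \<open>0\<close>, where \<open>\<phi>\<close> vanishes, replace the
        derivative of the Moebius transformation.\<close>
    have eq: "\<forall>\<^sub>F z in nhds 0. \<phi> z * (1 - cnj a * h z) = h z - a"
      using near by eventually_elim (use nz in \<open>simp add: \<phi>_def Moebius_function_def\<close>)
    have dh: "(h has_field_derivative deriv h 0) (at 0)"
      using h(1) by (intro holomorphic_derivI[of _ \<D>]) auto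
    have dp: "(\<phi> has_field_derivative deriv \<phi> 0) (at 0)"
      using \<phi>hol by (intro holomorphic_derivI[of _ \<D>]) auto
    have D1: "((\<lambda>z. \<phi> z * (1 - cnj a * h z)) has_field_derivative deriv \<phi> 0 * (1 - cnj a * a)) (at 0)"
      by (rule derivative_eq_intros dp dh refl | simp add: \<phi>0 a_def)+
    have D2: "((\<lambda>z. h z - a) has_field_derivative deriv h 0) (at 0)"
      by (rule derivative_eq_intros dh refl | simp)+
    have "deriv h 0 = deriv \<phi> 0 * (1 - cnj a * a)"
      using D1 D2 DERIV_cong_ev[OF refl eq refl] DERIV_unique by blast
    also have "1 - cnj a * a = of_real (1 - (cmod a)\<^sup>2)"
      by (simp add: complex_norm_square mult.commute del: of_real_power)
    finally have "cmod (deriv h 0) = cmod (deriv \<phi> 0) * (1 - (cmod a)\<^sup>2)"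
      using a by (simp add: norm_mult abs_square_le_1 del: of_real_diff)
    also have "\<dots> \<le> 1 * (1 - (cmod a)\<^sup>2)"
      using d1 a by (intro mult_right_mono) (simp_all add: abs_square_le_1)
    finally show ?thesis unfolding W1 W2 a_def by simp
  qed
qed

section \<open>Inverse logarithmic coefficients in terms of Taylor coefficients\<close>

text \<open>
  Exponentiating the logarithmic expansion \<open>L\<close> gives the local inverse as \<open>w exp (L(w))\<close> (the logarithm
  being a genuine one as \<open>g(w) \<noteq> 0\<close> for \<open>w \<noteq> 0\<close>), so the coefficients of \<open>w\<^sup>2\<close> and \<open>w\<^sup>3\<close> in
  \<open>f (w exp (L(w))) = w\<close> determine those of \<open>L\<close>.
\<close>
lemma inverse_log_expansion_nth_1_2:
  assumes A: "f has_fps_expansion A" and A0: "A $ 0 = 0" and A1: "A $ 1 = 1"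
    and "inverse_log_expansion f \<Gamma>"
  shows "\<Gamma> 1 = - (A $ 2) / 2" and "\<Gamma> 2 = - (A $ 3) / 2 + 3 / 4 * (A $ 2)\<^sup>2"
proof -
  obtain g where g: "local_inverse_at_0 f g"
    and s: "\<forall>\<^sub>F w in at 0. (\<lambda>n. 2 * (\<Gamma> (Suc n) * w ^ Suc n)) sums Ln (g w / w)"
    using assms(4) by (auto simp: inverse_log_expansion_def)
  have g0: "g 0 = 0" and fg: "\<forall>\<^sub>F w in nhds 0. f (g w) = w"
    using g by (auto simp: local_inverse_at_0_def)
  have f0: "f 0 = 0" using has_fps_expansion_imp_0_eq_fps_nth_0[OF A] A0 by simp
  \<comment> \<open>The expansion starts at index 1, so \<open>\<Gamma> 0\<close> is replaced by \<open>0\<close>, and \<open>l\<close> fills the gap at \<open>w = 0\<close>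
      with the limit value.\<close>
  define F where "F = Abs_fps (\<lambda>n. if n = 0 then 0 else 2 * \<Gamma> n)"
  define l where "l w = (if w = 0 then 0 else Ln (g w / w))" for w
  have "\<forall>\<^sub>F w in nhds 0. w \<noteq> 0 \<longrightarrow> (\<lambda>n. 2 * (\<Gamma> (Suc n) * w ^ Suc n)) sums Ln (g w / w)"
    using s by (simp add: eventually_at_filter)
  then have "\<forall>\<^sub>F w in nhds 0. (\<lambda>n. F $ n * w ^ n) sums l w"
  proof eventually_elim
    case (elim w)
    have "(\<lambda>n. F $ Suc n * w ^ Suc n) sums l w"
      using elim by (cases "w = 0") (simp_all add: F_def l_def mult.assoc)
    then show ?case by (subst (asm) sums_Suc_iff) (simp add: F_def)
  qed
  then have l: "l has_fps_expansion F" by (rule has_fps_expansionI)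
  have F0: "F $ 0 = 0" by (simp add: F_def)
  let ?E = "fps_exp 1 oo F"
  have "(exp \<circ> l) has_fps_expansion ?E"
    by (intro has_fps_expansion_compose has_fps_expansion_exp1 l F0)
  then have "(\<lambda>w. w * (exp \<circ> l) w) has_fps_expansion fps_X * ?E"
    by (rule has_fps_expansion_mult[OF has_fps_expansion_fps_X])
  moreover have "\<forall>\<^sub>F w in nhds 0. w * (exp \<circ> l) w = g w"
    using fg
  proof eventually_elim
    case (elim w)
    then have "w \<noteq> 0 \<Longrightarrow> g w \<noteq> 0" using f0 by auto
    then show ?case by (cases "w = 0") (simp_all add: l_def g0)
  qed
  ultimately have gE: "g has_fps_expansion fps_X * ?E"
    by (rule iffD1[OF has_fps_expansion_cong[OF _ refl], rotated])
  then have fgE: "(f \<circ> g) has_fps_expansion (A oo (fps_X * ?E))"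
    by (intro has_fps_expansion_compose A) auto
  have X: "A oo (fps_X * ?E) = fps_X"
    by (rule fps_expansion_unique_eventually[OF fgE has_fps_expansion_fps_X]) (use fg in simp)
  have B: "(fps_X * ?E) $ 0 = 0" "(fps_X * ?E) $ 1 = 1"
      "(fps_X * ?E) $ 2 = ?E $ 1" "(fps_X * ?E) $ 3 = ?E $ 2"
    by (simp_all add: eval_nat_numeral)
  have e2: "?E $ 1 + A $ 2 = 0"
    using arg_cong[OF X, of "\<lambda>F. F $ 2"] fps_compose_nth_1_2_3(2)[OF B(1), of A] B A1 by simp
  have e3: "?E $ 2 + 2 * A $ 2 * ?E $ 1 + A $ 3 = 0"
    using arg_cong[OF X, of "\<lambda>F. F $ 3"] fps_compose_nth_1_2_3(3)[OF B(1), of A] B A1 by simp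
  have E: "?E $ 1 = 2 * \<Gamma> 1" "?E $ 2 = 2 * \<Gamma> 2 + 2 * (\<Gamma> 1)\<^sup>2"
    using fps_exp_compose_nth_1_2[OF F0, of 1] by (simp_all add: F_def power_mult_distrib)
  show G1: "\<Gamma> 1 = - (A $ 2) / 2"
    using e2 unfolding E by (simp add: field_simps add_eq_0_iff)
  show "\<Gamma> 2 = - (A $ 3) / 2 + 3 / 4 * (A $ 2)\<^sup>2"
    using e3 unfolding E G1 by (simp add: power2_eq_square field_simps add_eq_0_iff)
qed

text \<open>
  The definite description behind \<open>inverse_log_coeff\<close> says something only if an expansion exists.
  The inverse function theorem provides \<open>g\<close>, and \<open>g(w) / w\<close> extends holomorphically with value
  \<open>g'(0) = 1\<close> at \<open>0\<close>, where the principal logarithm is holomorphic and vanishes.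
\<close>
lemma ex_inverse_log_expansion:
  assumes hol: "f holomorphic_on S" "open S" "0 \<in> S" and f0: "f 0 = 0" and f1: "deriv f 0 = 1"
  shows "\<exists>\<Gamma>. inverse_log_expansion f \<Gamma>"
proof -
  obtain r where r: "r > 0" "ball 0 r \<subseteq> S" "open (f ` ball 0 r)" "inj_on f (ball 0 r)"
    using has_complex_derivative_locally_invertible[OF hol(1,3,2)] f1 by (metis zero_neq_one)
  have holr: "f holomorphic_on ball 0 r" using hol(1) r(2) by (rule holomorphic_on_subset)
  obtain g where g: "g holomorphic_on f ` ball 0 r"
      "\<And>z. z \<in> ball 0 r \<Longrightarrow> deriv f z * deriv g (f z) = 1"
      "\<And>z. z \<in> ball 0 r \<Longrightarrow> g (f z) = z"
    using holomorphic_has_inverse[OF holr _ r(4)] by (metis open_ball)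
  have r0: "0 \<in> ball (0::complex) r" using r(1) by simp
  have g0: "g 0 = 0" and g1: "deriv g 0 = 1" using g(2,3)[OF r0] f0 f1 by simp_all
  have in0: "0 \<in> f ` ball 0 r" using r0 f0 by force
  have inv: "local_inverse_at_0 f g"
    unfolding local_inverse_at_0_def
  proof (intro conjI)
    show "g analytic_on {0}" using g(1) r(3) in0 analytic_at by blast
    have "\<forall>\<^sub>F w in nhds 0. w \<in> f ` ball 0 r" using r(3) in0 by (rule eventually_nhds_in_open)
    then show "\<forall>\<^sub>F w in nhds 0. f (g w) = w" by eventually_elim (auto simp: g(3))
    have "\<forall>\<^sub>F z :: complex in nhds 0. z \<in> ball 0 r" using r0 by (intro eventually_nhds_in_open open_ball)
    then show "\<forall>\<^sub>F z in nhds 0. g (f z) = z" by eventually_elim (rule g(3))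
  qed (rule g0)
  obtain s where s: "s > 0" "ball 0 s \<subseteq> f ` ball 0 r"
    using r(3) in0 openE by blast
  obtain h where h: "h holomorphic_on ball 0 s" "\<And>w. cmod w < s \<Longrightarrow> g w = w * h w" "deriv g 0 = h 0"
    using Schwarz3[OF holomorphic_on_subset[OF g(1) s(2)] g0] by metis
  have h0: "h 0 = 1" using h(3) g1 by simp
  have "h analytic_on {0}" using h(1) s(1) analytic_at by (metis centre_in_ball open_ball)
  then have "(\<lambda>w. Ln (h w)) analytic_on {0}"
    by (intro analytic_intros) (auto simp: h0)
  then obtain t where t: "t > 0" "(\<lambda>w. Ln (h w)) holomorphic_on ball 0 t"
    by (meson analytic_at_ball)
  let ?F = "fps_expansion (\<lambda>w. Ln (h w)) 0"
  have F: "(\<lambda>w. Ln (h w)) has_fps_expansion ?F"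
    using t by (intro has_fps_expansion_fps_expansion[of "ball 0 t"]) auto
  have F0: "?F $ 0 = 0" by (simp add: fps_expansion_def h0)
  have "inverse_log_expansion f (\<lambda>n. ?F $ n / 2)"
    unfolding inverse_log_expansion_def
  proof (intro exI conjI)
    show "local_inverse_at_0 f g" by (rule inv)
    have "\<forall>\<^sub>F w in at 0. w \<in> ball 0 (min s t) - {0}"
      using s(1) t(1) by (intro eventually_at_in_open) auto
    then show "\<forall>\<^sub>F w in at 0. (\<lambda>n. 2 * (?F $ Suc n / 2 * w ^ Suc n)) sums Ln (g w / w)"
    proof eventually_elim
      case (elim w)
      have "(\<lambda>n. ?F $ n * w ^ n) sums Ln (h w)"
        using has_fps_expansion_imp_sums_complex[OF F, of "ereal t" w] t(2) elim by simp
      then have "(\<lambda>n. ?F $ Suc n * w ^ Suc n) sums Ln (h w)"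
        by (subst sums_Suc_iff) (simp add: F0)
      moreover have "g w / w = h w" using h(2)[of w] elim by simp
      ultimately show ?case by simp
    qed
  qed
  then show ?thesis by blast
qed

lemma class_A_fps_expansion:
  assumes "f \<in> class_A"
  obtains A where "f has_fps_expansion A" "A $ 0 = 0" "A $ 1 = 1"
proof -
  from assms obtain a where a: "a 0 = 0" "a 1 = 1" "\<forall>z\<in>\<D>. (\<lambda>n. a n * z ^ n) sums f z"
    by (auto simp: class_A_def)
  have "\<forall>\<^sub>F z in nhds 0. z \<in> \<D>" by (intro eventually_nhds_in_open) auto
  then have "f has_fps_expansion Abs_fps a"
    by (intro has_fps_expansionI) (use a(3) in \<open>auto elim!: eventually_mono\<close>)
  then show ?thesis using that a by simp
qed

lemma inverse_log_coeff_1_2: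
  assumes f: "f \<in> class_A" and A: "f has_fps_expansion A"
  shows "inverse_log_coeff f 1 = - (A $ 2) / 2"
    and "inverse_log_coeff f 2 = - (A $ 3) / 2 + 3 / 4 * (A $ 2)\<^sup>2"
proof -
  have A01: "A $ 0 = 0" "A $ 1 = 1"
    using class_A_fps_expansion[OF f] A fps_expansion_unique_complex by metis+
  have "f 0 = 0" "deriv f 0 = 1"
    using fps_nth_fps_expansion[OF A, of 0] fps_nth_fps_expansion[OF A, of 1] A01 by simp_all
  moreover have "f holomorphic_on \<D>" using f by (simp add: class_A_def)
  ultimately obtain \<Gamma> where G: "inverse_log_expansion f \<Gamma>"
    using ex_inverse_log_expansion[of f \<D>] by auto
  note uniq = inverse_log_expansion_nth_1_2[OF A A01]
  show "inverse_log_coeff f 1 = - (A $ 2) / 2"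
    unfolding inverse_log_coeff_def using G uniq(1) by (intro the_equality) blast+
  show "inverse_log_coeff f 2 = - (A $ 3) / 2 + 3 / 4 * (A $ 2)\<^sup>2"
    unfolding inverse_log_coeff_def using G uniq(2) by (intro the_equality) blast+
qed

section \<open>Starlike functions generated by a Schwarz function\<close>

text \<open>
  At order \<open>n\<close> the equation \<open>z f' = f exp (c \<omega>)\<close> contains \<open>n a\<^sub>n\<close> on the left and \<open>a\<^sub>n\<close> on the
  right, so it can be solved recursively for \<open>a\<^sub>2\<close> and \<open>a\<^sub>3\<close>.
\<close>
lemma inverse_log_coeff_schwarz:
  assumes f: "f \<in> class_A" and W: "\<omega> has_fps_expansion W" and w0: "\<omega> 0 = 0"
    and q: "\<And>z. z \<in> \<D> \<Longrightarrow> starlike_quotient f z = exp (c * \<omega> z)"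
  shows "inverse_log_coeff f 1 = - (c * W $ 1) / 2"
    and "inverse_log_coeff f 2 = 3 / 8 * c\<^sup>2 * (W $ 1)\<^sup>2 - c / 4 * W $ 2"
proof -
  obtain A where A: "f has_fps_expansion A" and A0: "A $ 0 = 0" and A1: "A $ 1 = 1"
    using class_A_fps_expansion[OF f] .
  have W0: "W $ 0 = 0" using has_fps_expansion_imp_0_eq_fps_nth_0[OF W] w0 by simp
  have f0: "f 0 = 0" using has_fps_expansion_imp_0_eq_fps_nth_0[OF A] A0 by simp
  let ?E = "fps_exp c oo W"
  have "((\<lambda>x. exp (c * x)) \<circ> \<omega>) has_fps_expansion ?E"
    by (intro has_fps_expansion_compose has_fps_expansion_exp W W0)
  then have R: "(\<lambda>z. f z * ((\<lambda>x. exp (c * x)) \<circ> \<omega>) z) has_fps_expansion A * ?E"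
    by (rule has_fps_expansion_mult[OF A])
  have L: "(\<lambda>z. z * deriv f z) has_fps_expansion fps_X * fps_deriv A"
    by (intro fps_expansion_intros A)
  have "\<forall>\<^sub>F z in nhds 0. z \<in> \<D>" by (intro eventually_nhds_in_open) auto
  then have "\<forall>\<^sub>F z in nhds 0. z * deriv f z = f z * ((\<lambda>x. exp (c * x)) \<circ> \<omega>) z"
  proof eventually_elim
    case (elim z)
    show ?case
    proof (cases "z = 0")
      case False
      with q[OF elim] have e: "z * deriv f z / f z = exp (c * \<omega> z)"
        by (simp add: starlike_quotient_def)
      \<comment> \<open>A zero of \<open>f\<close> would make the quotient \<open>0\<close>, which is not a value of the exponential.\<close>
      then have "f z \<noteq> 0" by auto
      with e show ?thesis by (simp add: field_simps)
    qed (simp add: f0)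
  qed
  then have eq: "fps_X * fps_deriv A = A * ?E"
    by (rule fps_expansion_unique_eventually[OF L R])
  have E0: "?E $ 0 = 1" by simp
  have E: "?E $ 1 = c * W $ 1" "?E $ 2 = c * W $ 2 + c\<^sup>2 / 2 * (W $ 1)\<^sup>2"
    using fps_exp_compose_nth_1_2[OF W0, of c] by auto
  have "2 * A $ 2 = A $ 2 + ?E $ 1"
    using arg_cong[OF eq, of "\<lambda>F. F $ 2"] A0 A1 E0
    by (simp add: fps_mult_nth eval_nat_numeral)
  then have A2: "A $ 2 = c * W $ 1" using E by simp
  have "3 * A $ 3 = A $ 3 + A $ 2 * ?E $ 1 + ?E $ 2"
    using arg_cong[OF eq, of "\<lambda>F. F $ 3"] A0 A1 E0
    by (simp add: fps_mult_nth eval_nat_numeral)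
  then have A3: "A $ 3 = c / 2 * W $ 2 + 3 / 4 * c\<^sup>2 * (W $ 1)\<^sup>2"
    unfolding A2 E by (simp add: field_simps power2_eq_square)
  show "inverse_log_coeff f 1 = - (c * W $ 1) / 2"
    and "inverse_log_coeff f 2 = 3 / 8 * c\<^sup>2 * (W $ 1)\<^sup>2 - c / 4 * W $ 2"
    using inverse_log_coeff_1_2[OF f A] unfolding A2 A3
    by (simp_all add: field_simps power2_eq_square)
qed

text \<open>
  With a primitive \<open>p\<close> of \<open>q(z) = (exp (\<alpha> \<omega>(z)) - 1) / z\<close> normalised by \<open>p(0) = 0\<close>, the function
  \<open>f(z) = z exp (p(z))\<close> has logarithmic derivative \<open>1 / z + q(z)\<close>, hence \<open>z f'(z) / f(z) = exp (\<alpha> \<omega>(z))\<close>.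
\<close>
lemma ex_class_S_ex:
  assumes hol: "\<omega> holomorphic_on \<D>" and maps: "\<omega> ` \<D> \<subseteq> \<D>" and zero: "\<omega> 0 = 0"
  shows "\<exists>f \<in> class_S_ex \<alpha>. \<forall>z\<in>\<D>. starlike_quotient f z = exp (complex_of_real \<alpha> * \<omega> z)"
proof -
  let ?e = "\<lambda>z. exp (complex_of_real \<alpha> * \<omega> z)"
  have ehol: "?e holomorphic_on \<D>" by (intro holomorphic_intros hol)
  have "(\<lambda>z. ?e z - 1) holomorphic_on \<D>" by (intro holomorphic_intros hol)
  from Schwarz3[OF this] zero obtain q
    where q: "q holomorphic_on \<D>" "\<And>z. cmod z < 1 \<Longrightarrow> ?e z - 1 = z * q z"
    by (auto simp: mult.commute)
  obtain p0 where p0: "\<And>z. z \<in> \<D> \<Longrightarrow> (p0 has_field_derivative q z) (at z within \<D>)"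
    using holomorphic_convex_primitive'[OF convex_ball open_ball q(1)] by metis
  define f where "f z = z * exp (p0 z - p0 0)" for z
  have df: "(f has_field_derivative exp (p0 z - p0 0) * ?e z) (at z)" if "z \<in> \<D>" for z
  proof -
    have "(p0 has_field_derivative q z) (at z)"
      using p0[OF that] that by (simp add: at_within_open[OF that open_ball])
    then have "(f has_field_derivative exp (p0 z - p0 0) * (1 + z * q z)) (at z)"
      unfolding f_def by (auto intro!: derivative_eq_intros simp: algebra_simps)
    moreover have "1 + z * q z = ?e z" using q(2)[of z] that by (simp add: algebra_simps)
    ultimately show ?thesis by simp
  qed
  have fhol: "f holomorphic_on \<D>"
    using df by (meson holomorphic_onI field_differentiable_at_within field_differentiable_def)
  have "f \<in> class_A"
    unfolding class_A_def
  proof (intro CollectI conjI exI ballI)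
    show "f holomorphic_on \<D>" by (rule fhol)
    show "(deriv ^^ 0) f 0 / fact 0 = 0" by (simp add: f_def)
    show "(deriv ^^ 1) f 0 / fact 1 = 1" using DERIV_imp_deriv[OF df[of 0]] zero by simp
    show "(\<lambda>n. (deriv ^^ n) f 0 / fact n * z ^ n) sums f z" if "z \<in> \<D>" for z
      using holomorphic_power_series[OF fhol that] by simp
  qed
  moreover have quot: "starlike_quotient f z = ?e z" if "z \<in> \<D>" for z
    using DERIV_imp_deriv[OF df[OF that]] zero by (simp add: starlike_quotient_def f_def)
  moreover have "starlike_quotient f \<prec>\<^sub>D (\<lambda>z. exp (complex_of_real \<alpha> * z))"
    unfolding subordinate_def
  proof (intro conjI exI)
    show "starlike_quotient f holomorphic_on \<D>"
      using ehol quot by (metis (mono_tags, lifting) holomorphic_transform)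
    show "(\<lambda>z. exp (complex_of_real \<alpha> * z)) holomorphic_on \<D>" by (intro holomorphic_intros)
    show "\<forall>z\<in>\<D>. starlike_quotient f z = exp (complex_of_real \<alpha> * \<omega> z)" using quot by blast
  qed (use assms in auto)
  ultimately show ?thesis unfolding class_S_ex_def by blast
qed

section \<open>The extremal problem for the coefficients\<close>

text \<open>
  Here \<open>c\<close> and \<open>d\<close> stand for the first two coefficients of a Schwarz function, so that \<open>D\<close> is
  \<open>\<bar>\<Gamma>\<^sub>2\<bar> - \<bar>\<Gamma>\<^sub>1\<bar>\<close>.  Only the moduli of \<open>c\<close> and \<open>d\<close> enter, through the triangle inequality.
\<close>
lemma coeff_difference_bounds:
  fixes \<alpha> :: real and c d :: complex
  assumes "0 < \<alpha>" "\<alpha> \<le> 1" and d: "cmod d \<le> 1 - (cmod c)\<^sup>2"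
  defines "D \<equiv> cmod (3 / 8 * of_real \<alpha> ^ 2 * c\<^sup>2 - of_real \<alpha> / 4 * d) - cmod (- (of_real \<alpha> * c) / 2)"
  shows "- (\<alpha> / 2) * sqrt (2 / (3 * \<alpha> + 2)) \<le> D" and "D \<le> \<alpha> / 4"
proof -
  define x where "x = cmod c"
  define b where "b = sqrt (2 / (3 * \<alpha> + 2))"
  have x: "0 \<le> x" "x \<le> 1"
    using order_trans[OF norm_ge_zero d] abs_square_le_1[of "cmod c"] unfolding x_def by auto
  have b: "0 < b" "b\<^sup>2 * (3 * \<alpha> + 2) = 2" "b < 1"
    using assms(1) by (simp_all add: b_def field_simps)
  have n1: "cmod (- (of_real \<alpha> * c) / 2) = \<alpha> * x / 2"
    using assms(1) by (simp add: norm_mult norm_divide x_def)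
  have n2: "cmod (3 / 8 * of_real \<alpha> ^ 2 * c\<^sup>2) = 3 / 8 * \<alpha>\<^sup>2 * x\<^sup>2"
    using assms(1) by (simp add: norm_mult norm_divide norm_power x_def)
  have "cmod (of_real \<alpha> / 4 * d) = \<alpha> / 4 * cmod d"
    using assms(1) by (simp add: norm_mult norm_divide)
  also have "\<dots> \<le> \<alpha> / 4 * (1 - x\<^sup>2)"
    using assms(1) d by (intro mult_left_mono) (auto simp: x_def)
  finally have n3: "cmod (of_real \<alpha> / 4 * d) \<le> \<alpha> / 4 * (1 - x\<^sup>2)" .
  have "D \<le> 3 / 8 * \<alpha>\<^sup>2 * x\<^sup>2 + \<alpha> / 4 * (1 - x\<^sup>2) - \<alpha> * x / 2"
    unfolding D_def n1 using norm_triangle_ineq4[of "3 / 8 * of_real \<alpha> ^ 2 * c\<^sup>2" "of_real \<alpha> / 4 * d"]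
    n2 n3 by linarith
  also have "\<dots> = \<alpha> / 4 - \<alpha> / 8 * x * (4 - (3 * \<alpha> - 2) * x)"
    by (simp add: field_simps power2_eq_square)
  also have "\<dots> \<le> \<alpha> / 4"
  proof -
    have "(3 * \<alpha> - 2) * x \<le> 1 * x" using x assms by (intro mult_right_mono) auto
    then have "0 \<le> 4 - (3 * \<alpha> - 2) * x" using x by linarith
    then show ?thesis using x assms(1) by simp
  qed
  finally show "D \<le> \<alpha> / 4" .
  have "- (\<alpha> / 2) * b \<le> D"
  proof (cases "x \<le> b")
    case True
    then have "\<alpha> * x / 2 \<le> \<alpha> * b / 2" using assms(1) by simp
    moreover have "- (\<alpha> * x / 2) \<le> D" unfolding D_def n1 by simp
    ultimately show ?thesis by simp
  next
    case False
    \<comment> \<open>The triangle inequality bounds \<open>D\<close> below by a quadratic in \<open>x\<close> that equals \<open>-\<alpha> b / 2\<close> at \<open>x = b\<close>;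
        its increment from \<open>b\<close> is \<open>\<alpha> (x - b) ((3 \<alpha> + 2) (x + b) - 4) / 8\<close>, and the last factor is
        nonnegative because \<open>x > b \<ge> b\<^sup>2 = 2 / (3 \<alpha> + 2)\<close>.\<close>
    have "(3 * \<alpha> + 2) * (x + b) \<ge> (3 * \<alpha> + 2) * (2 * b\<^sup>2)"
    proof (intro mult_left_mono)
      have "b\<^sup>2 \<le> b" using b by (simp add: power2_eq_square mult_left_le_one_le)
      then show "2 * b\<^sup>2 \<le> x + b" using False by simp
    qed (use assms in simp)
    then have "0 \<le> (3 * \<alpha> + 2) * (x + b) - 4" using b(2) by (simp add: algebra_simps)
    then have "0 \<le> \<alpha> / 8 * ((x - b) * ((3 * \<alpha> + 2) * (x + b) - 4))"
      using False assms(1) by simp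
    also have "\<dots> = 3 / 8 * \<alpha>\<^sup>2 * x\<^sup>2 - \<alpha> / 4 * (1 - x\<^sup>2) - \<alpha> * x / 2 + \<alpha> / 2 * b
        + \<alpha> / 8 * (2 - b\<^sup>2 * (3 * \<alpha> + 2))"
      by (simp add: field_simps power2_eq_square)
    also have "\<dots> = 3 / 8 * \<alpha>\<^sup>2 * x\<^sup>2 - \<alpha> / 4 * (1 - x\<^sup>2) - \<alpha> * x / 2 + \<alpha> / 2 * b"
      using b(2) by simp
    also have "\<dots> \<le> D + \<alpha> / 2 * b"
      unfolding D_def n1
      using norm_triangle_ineq2[of "3 / 8 * of_real \<alpha> ^ 2 * c\<^sup>2" "of_real \<alpha> / 4 * d"] n2 n3
      by linarith
    finally show ?thesis by simp
  qed
  then show "- (\<alpha> / 2) * sqrt (2 / (3 * \<alpha> + 2)) \<le> D" by (simp add: b_def)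
qed

section \<open>Extremal functions\<close>

text \<open>
  The Blaschke product \<open>z (z + b) / (1 + b z)\<close> attains equality in the Schwarz--Pick inequality for
  the second coefficient, with prescribed first coefficient \<open>b\<close>.
\<close>
lemma blaschke_schwarz_function:
  assumes b: "0 \<le> b" "b < 1"
  defines "\<omega> \<equiv> \<lambda>z. z * Moebius_function 0 (- complex_of_real b) z"
  shows "\<omega> holomorphic_on \<D>" "\<omega> ` \<D> \<subseteq> \<D>" "\<omega> 0 = 0"
    and "\<omega> has_fps_expansion W \<Longrightarrow> W $ 1 = b \<and> W $ 2 = 1 - b\<^sup>2"
proof -
  have nb: "cmod (- complex_of_real b) < 1" using b by simp
  show hol: "\<omega> holomorphic_on \<D>"
    unfolding \<omega>_def by (intro holomorphic_intros Moebius_function_holomorphic[OF nb])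
  show "\<omega> ` \<D> \<subseteq> \<D>"
  proof clarsimp
    fix z :: complex assume z: "cmod z < 1"
    have "cmod z * cmod (Moebius_function 0 (- complex_of_real b) z) \<le> cmod z * 1"
      using Moebius_function_norm_lt_1[OF nb z, of 0] by (intro mult_left_mono) auto
    then show "cmod (\<omega> z) < 1" using z by (simp add: \<omega>_def norm_mult)
  qed
  show \<omega>0: "\<omega> 0 = 0" by (simp add: \<omega>_def)
  assume W: "\<omega> has_fps_expansion W"
  have W0: "W $ 0 = 0" using has_fps_expansion_imp_0_eq_fps_nth_0[OF W] \<omega>0 by simp
  let ?b = "complex_of_real b"
  have L: "(\<lambda>z. \<omega> z * (1 + ?b * z)) has_fps_expansion W * (1 + fps_const ?b * fps_X)"
    by (intro fps_expansion_intros W)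
  have R: "(\<lambda>z. z * (z + ?b)) has_fps_expansion fps_X * (fps_X + fps_const ?b)"
    by (intro fps_expansion_intros)
  have "\<forall>\<^sub>F z in nhds 0. z \<in> \<D>" by (intro eventually_nhds_in_open) auto
  then have "\<forall>\<^sub>F z in nhds 0. \<omega> z * (1 + ?b * z) = z * (z + ?b)"
  proof eventually_elim
    case (elim z)
    have "cmod (?b * z) < 1"
    proof -
      have "b * cmod z \<le> b * 1" using b elim by (intro mult_left_mono) auto
      then show ?thesis using b by (simp add: norm_mult)
    qed
    then have "1 + ?b * z \<noteq> 0"
      by (metis add_eq_0_iff norm_minus_cancel norm_one order_less_irrefl)
    then show ?case by (simp add: \<omega>_def Moebius_function_def)
  qed
  then have eq: "W * (1 + fps_const ?b * fps_X) = fps_X * (fps_X + fps_const ?b)"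
    by (rule fps_expansion_unique_eventually[OF L R])
  have "W $ 1 = ?b"
    using arg_cong[OF eq, of "\<lambda>F. F $ 1"] W0 by (simp add: fps_mult_nth)
  moreover have "W $ 2 + W $ 1 * ?b = 1"
    using arg_cong[OF eq, of "\<lambda>F. F $ 2"] W0
    by (simp add: fps_mult_nth eval_nat_numeral add.commute)
  ultimately show "W $ 1 = b \<and> W $ 2 = 1 - b\<^sup>2"
    by (simp add: power2_eq_square algebra_simps eq_diff_eq)
qed

text \<open>
  The formula for \<open>\<Gamma>\<^sub>2\<close> is factored to show its zero at \<open>b\<^sup>2 = 2 / (3 \<alpha> + 2)\<close>.
\<close>
lemma ex_class_S_ex_blaschke:
  assumes "0 \<le> b" "b < 1"
  shows "\<exists>f \<in> class_S_ex \<alpha>. inverse_log_coeff f 1 = - (\<alpha> * b) / 2 \<and>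
           inverse_log_coeff f 2 = \<alpha> / 8 * ((3 * \<alpha> + 2) * b\<^sup>2 - 2)"
proof -
  let ?\<omega> = "\<lambda>z. z * Moebius_function 0 (- complex_of_real b) z"
  note B = blaschke_schwarz_function[OF assms]
  have W: "?\<omega> has_fps_expansion fps_expansion ?\<omega> 0"
    using B(1) by (intro has_fps_expansion_fps_expansion[of \<D>]) auto
  obtain f where f: "f \<in> class_S_ex \<alpha>"
      "\<forall>z\<in>\<D>. starlike_quotient f z = exp (complex_of_real \<alpha> * ?\<omega> z)"
    using ex_class_S_ex[OF B(1-3)] by blast
  have fA: "f \<in> class_A" using f(1) by (simp add: class_S_ex_def)
  show ?thesis
    using inverse_log_coeff_schwarz[OF fA W B(3), of \<alpha>] f B(4)[OF W]
    by (intro bexI[of _ f]) (simp_all add: field_simps power2_eq_square)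
qed

section \<open>Sharp bounds for the difference of moduli\<close>

theorem theorem4p1:
  fixes \<alpha> :: real
  assumes "0 < \<alpha>" and "\<alpha> \<le> 1"
  shows "(\<forall>f \<in> class_S_ex \<alpha>.
            - (\<alpha> / 2) * sqrt (2 / (3 * \<alpha> + 2))
              \<le> cmod (inverse_log_coeff f 2) - cmod (inverse_log_coeff f 1)
          \<and> cmod (inverse_log_coeff f 2) - cmod (inverse_log_coeff f 1) \<le> \<alpha> / 4)
       \<and> (\<exists>f \<in> class_S_ex \<alpha>.
            cmod (inverse_log_coeff f 2) - cmod (inverse_log_coeff f 1)
              = - (\<alpha> / 2) * sqrt (2 / (3 * \<alpha> + 2)))
       \<and> (\<exists>f \<in> class_S_ex \<alpha>.
            cmod (inverse_log_coeff f 2) - cmod (inverse_log_coeff f 1) = \<alpha> / 4)"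
proof (intro conjI ballI)
  fix f assume f: "f \<in> class_S_ex \<alpha>"
  then have fA: "f \<in> class_A" by (simp add: class_S_ex_def)
  from f obtain \<omega> where w: "\<omega> holomorphic_on \<D>" "\<omega> ` \<D> \<subseteq> \<D>" "\<omega> 0 = 0"
      and q: "\<And>z. z \<in> \<D> \<Longrightarrow> starlike_quotient f z = exp (complex_of_real \<alpha> * \<omega> z)"
    by (auto simp: class_S_ex_def subordinate_def)
  have W: "\<omega> has_fps_expansion fps_expansion \<omega> 0"
    using w(1) by (intro has_fps_expansion_fps_expansion[of \<D>]) auto
  let ?W = "fps_expansion \<omega> 0"
  have coeffs: "inverse_log_coeff f 1 = - (of_real \<alpha> * ?W $ 1) / 2"
      "inverse_log_coeff f 2 = 3 / 8 * (of_real \<alpha>)\<^sup>2 * (?W $ 1)\<^sup>2 - of_real \<alpha> / 4 * ?W $ 2"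
    using inverse_log_coeff_schwarz[OF fA W w(3), of "of_real \<alpha>"] q by blast+
  note bounds = coeff_difference_bounds[OF assms schwarz_pick_second_coeff[OF w W]]
  show "- (\<alpha> / 2) * sqrt (2 / (3 * \<alpha> + 2))
      \<le> cmod (inverse_log_coeff f 2) - cmod (inverse_log_coeff f 1)"
    unfolding coeffs by (rule bounds(1))
  show "cmod (inverse_log_coeff f 2) - cmod (inverse_log_coeff f 1) \<le> \<alpha> / 4"
    unfolding coeffs by (rule bounds(2))
next
  define b where "b = sqrt (2 / (3 * \<alpha> + 2))"
  have b: "0 \<le> b" "b < 1" "(3 * \<alpha> + 2) * b\<^sup>2 = 2"
    using assms(1) by (simp_all add: b_def field_simps)
  obtain f where f: "f \<in> class_S_ex \<alpha>" "inverse_log_coeff f 1 = - (\<alpha> * b) / 2"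
      "inverse_log_coeff f 2 = \<alpha> / 8 * ((3 * \<alpha> + 2) * b\<^sup>2 - 2)"
    using ex_class_S_ex_blaschke[OF b(1,2)] by blast
  have "cmod (inverse_log_coeff f 2) = 0" unfolding f(3) b(3) by simp
  moreover have "cmod (inverse_log_coeff f 1) = \<alpha> * b / 2"
    unfolding f(2) using assms(1) b(1) by (simp add: norm_mult norm_divide)
  ultimately show "\<exists>f \<in> class_S_ex \<alpha>. cmod (inverse_log_coeff f 2) - cmod (inverse_log_coeff f 1)
      = - (\<alpha> / 2) * sqrt (2 / (3 * \<alpha> + 2))"
    using f(1) by (intro bexI[of _ f]) (simp_all add: b_def)
next
  obtain f where f: "f \<in> class_S_ex \<alpha>" "inverse_log_coeff f 1 = 0" "inverse_log_coeff f 2 = - \<alpha> / 4"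
    using ex_class_S_ex_blaschke[of 0 \<alpha>] by auto
  then show "\<exists>f \<in> class_S_ex \<alpha>. cmod (inverse_log_coeff f 2) - cmod (inverse_log_coeff f 1) = \<alpha> / 4"
    using assms(1) by (intro bexI[of _ f]) (simp_all add: norm_divide)
qed

end
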